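(* There exist periodic trees with no invariant measure on their orbit. That is, there exists a periodic tree $\mathfrak A:\mathbb F_2^+\to\{0,1\}$ such that there is no invariant probability measure on its (finite) orbit $\mathcal O=\{T_\omega(\mathfrak A):\omega\in\mathbb F_2^+\}$.
   Context: $\mathbb F_2^+$ is the free monoid of finite words over $\{a,b\}$, with identity $e$. A tree is a map $\mathfrak A:\mathbb F_2^+\to\{0,1\}$. The action is $(T_a\mathfrak A)_x=\mathfrak A_{ax}$, $(T_b\mathfrak A)_x=\mathfrak A_{bx}$, and $T_\omega=T_{\omega_1}\circ\cdots\circ T_{\omega_n}$ for $\omega=\omega_1\ldots\omega_n$ ($T_e$ is the identity). A tree $\mathfrak A$ is periodic if its orbit $\mathcal O=\{T_\omega(\mathfrak A):\omega\in\mathbb F_2^+\}$ is finite and $T_a(\mathcal O)\cup T_b(\mathcal O)=\mathcal O$. A probability measure $\mu$ on $\mathcal O$ is invariant if $\mu(E)=\mu(T_a^{-1}(E))=\mu(T_b^{-1}(E))$ for every (Borel) set $E\subseteq\mathcal O$, where the preimages are taken in $\mathcal O$. *)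

theory Defs
  imports "HOL-Probability.Probability"
begin

datatype letter = Letter_a | Letter_b

type_synonym word = "letter list"

(* The label set {0,1} is rendered by bool, with False for 0 and True for 1.
   The library's topology on this function type is the product topology of the
   discrete topology on bool. *)
type_synonym tree = "word \<Rightarrow> bool"

definition T_letter :: "letter \<Rightarrow> tree \<Rightarrow> tree" where
  "T_letter l A = (\<lambda>x. A (l # x))"

abbreviation T_a :: "tree \<Rightarrow> tree" where
  "T_a \<equiv> T_letter Letter_a"

abbreviation T_b :: "tree \<Rightarrow> tree" where
  "T_b \<equiv> T_letter Letter_b"

(* The last letter of the word acts first. *)
fun T_word :: "word \<Rightarrow> tree \<Rightarrow> tree" where
  "T_word [] = id"
| "T_word (l # w) = T_letter l \<circ> T_word w"

definition orbit :: "tree \<Rightarrow> tree set" where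
  "orbit A = {T_word w A |w. True}"

definition periodic :: "tree \<Rightarrow> bool" where
  "periodic A \<longleftrightarrow>
     finite (orbit A) \<and> T_a ` orbit A \<union> T_b ` orbit A = orbit A"

definition invariant_probability_measure :: "tree set \<Rightarrow> tree measure \<Rightarrow> bool" where
  "invariant_probability_measure S M \<longleftrightarrow>
     prob_space M \<and> space M = S \<and> sets M = sets (restrict_space borel S) \<and>
     (\<forall>E \<in> sets M. measure M E = measure M (T_a -` E \<inter> S) \<and>
                   measure M E = measure M (T_b -` E \<inter> S))"

end

theory Submission
  imports Defs
begin

text \<open>
  A common invariant measure of two self-maps of a finite set must live on the periodic points
  of both maps, so it suffices that \<open>T_a\<close> and \<open>T_b\<close> are constant on the orbit with different
  values. A tree with this property remembers only the last letter of the word: its label at a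
  nonempty word says whether the word ends in \<open>a\<close>. Passing to the subtree at \<open>a\<close> or \<open>b\<close> then
  forgets everything except the letter just read, which becomes the label of the new root.
  Hence the orbit consists of two trees, distinguished by their root label, and \<open>T_a\<close> maps both
  to the one while \<open>T_b\<close> maps both to the other. The preimage of the first tree is everything
  under \<open>T_a\<close> and nothing under \<open>T_b\<close>, so an invariant measure would give it mass 1 and mass 0.
\<close>

definition last_letter_tree :: "bool \<Rightarrow> tree" where
  "last_letter_tree r w = (if w = [] then r else last w = Letter_a)"

lemma last_letter_tree_Nil [simp]: "last_letter_tree r [] = r"
  by (simp add: last_letter_tree_def)

lemma T_letter_last_letter_tree:
  "T_letter l (last_letter_tree r) = last_letter_tree (l = Letter_a)"
  by (auto simp: T_letter_def last_letter_tree_def fun_eq_iff)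

lemma T_word_last_letter_tree:
  "T_word w (last_letter_tree r) =
     last_letter_tree (if w = [] then r else hd w = Letter_a)"
proof (induction w)
  case Nil
  then show ?case by simp
next
  case (Cons l w)
  then show ?case by (simp add: T_letter_last_letter_tree)
qed

lemma orbit_last_letter_tree: "orbit (last_letter_tree r) = range last_letter_tree"
proof
  show "orbit (last_letter_tree r) \<subseteq> range last_letter_tree"
    by (auto simp: orbit_def T_word_last_letter_tree)
  have "last_letter_tree s \<in> orbit (last_letter_tree r)" for s
  proof -
    have "T_word [if s then Letter_a else Letter_b] (last_letter_tree r) = last_letter_tree s"
      by (simp add: T_letter_last_letter_tree)
    then show ?thesis
      unfolding orbit_def by (metis (mono_tags, lifting) mem_Collect_eq)
  qed
  then show "range last_letter_tree \<subseteq> orbit (last_letter_tree r)"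
    by blast
qed

lemma periodic_last_letter_tree: "periodic (last_letter_tree r)"
  by (auto simp: periodic_def orbit_last_letter_tree image_image T_letter_last_letter_tree
      UNIV_bool)

text \<open>The root label is a coordinate of the product space, hence continuous, and \<open>{True}\<close> is
  open in the discrete space of labels.\<close>

lemma borel_root_label: "{A :: tree. A []} \<in> sets borel"
proof -
  have "open ((\<lambda>A :: tree. A []) -` {True})"
    by (rule open_vimage[OF Topological_Spaces.open_discrete continuous_on_product_coordinates])
  then show ?thesis
    by (simp add: vimage_def)
qed

lemma no_invariant_probability_measure_last_letter_tree:
  "\<not> invariant_probability_measure (orbit (last_letter_tree r)) M"
proof
  let ?S = "orbit (last_letter_tree r)"
  let ?E = "{A \<in> ?S. A []}"
  assume "invariant_probability_measure ?S M"
  then have M: "prob_space M" "space M = ?S" "sets M = sets (restrict_space borel ?S)"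
    and inv: "\<And>E. E \<in> sets M \<Longrightarrow>
      measure M E = measure M (T_a -` E \<inter> ?S) \<and> measure M E = measure M (T_b -` E \<inter> ?S)"
    unfolding invariant_probability_measure_def by blast+
  have "?E = ?S \<inter> {A. A []}"
    by blast
  then have "?E \<in> sets M"
    unfolding M(3) sets_restrict_space using borel_root_label by blast
  moreover have "T_a -` ?E \<inter> ?S = ?S" "T_b -` ?E \<inter> ?S = {}"
    by (auto simp: orbit_last_letter_tree T_letter_last_letter_tree)
  ultimately have "measure M ?S = measure M {}"
    using inv by metis
  then show False
    using prob_space.prob_space[OF M(1)] M(2) by simp
qed

theorem theorem1p5:
  shows "\<exists>A :: tree. periodic A \<and> \<not> (\<exists>M. invariant_probability_measure (orbit A) M)"
  using periodic_last_letter_tree no_invariant_probability_measure_last_letter_tree by blast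

end
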